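(* Let $B$ be an Alexandroff space and let $D\colon B\to \mathbf{Ord}$ be a functor. Let $\iota_C\colon\mathbf{Ord}\to\mathbf{Cat}$ be the usual inclusion functor and let $\iota_T\colon\mathbf{Ord}\to\mathbf{Top}$ be the functor that takes every preordered set to the corresponding Alexandroff space. Consider the compositions $D_C=\iota_C D$ and $D_T=\iota_T D$. Then the Grothendieck construction $\int D_C$ (which is a preordered set), regarded as an Alexandroff space, coincides with the topological Grothendieck construction $\int D_T$.
   Context: An Alexandroff space is a topological space in which arbitrary intersections of open sets are open. In an Alexandroff space $X$ each $x$ has a minimal open neighbourhood $U_x$, and $x\leq y \iff U_x\subseteq U_y$ defines a preorder; the open sets are exactly the lower sets and $U_x=\{y\in X : y\leq x\}$. Alexandroff spaces are thereby identified with preordered sets, and continuous maps between them with order-preserving maps. A preordered set is regarded as a thin category with a unique arrow (denoted $x\leq y$) from $x$ to $y$ whenever $x\leq y$. $\mathbf{Ord}$, $\mathbf{Cat}$, $\mathbf{Top}$ are the categories of preordered sets, small categories and topological spaces. The Grothendieck construction $\int D_C$ has objects the pairs $(b,x)$ with $b\in B$, $x\in D(b)$; here it is a preordered set, with $(b,x)\leq(b',x')$ iff $b\leq b'$ in $B$ and $D(b\leq b')(x)\leq x'$ in $D(b')$. Topological Grothendieck construction: for a functor $G\colon B\to\mathbf{Top}$, $\int G=\bigcup_{b\in B}\{b\}\times G(b)$, with the topology having as basis the sets $J_G(b,V)=\bigcup_{v\in U_b}\{v\}\times G(v\leq b)^{-1}(V)$, for $b\in B$ and $V\subseteq G(b)$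 open. *)

theory Defs
  imports "HOL-Analysis.Analysis"
begin

section \<open>Small categories and functors\<close>

text \<open>
  Composition is written in applicative order: \<open>Comp C g f\<close> is \<open>g\<close> after \<open>f\<close>.
\<close>

record ('o, 'a) category =
  Obj :: "'o set"
  Arr :: "'a set"
  Dom :: "'a \<Rightarrow> 'o"
  Cod :: "'a \<Rightarrow> 'o"
  Ide :: "'o \<Rightarrow> 'a"
  Comp :: "'a \<Rightarrow> 'a \<Rightarrow> 'a"

definition is_category :: "('o, 'a) category \<Rightarrow> bool" where
  "is_category C \<longleftrightarrow>
     (\<forall>f\<in>Arr C. Dom C f \<in> Obj C \<and> Cod C f \<in> Obj C) \<and>
     (\<forall>x\<in>Obj C. Ide C x \<in> Arr C \<and> Dom C (Ide C x) = x \<and> Cod C (Ide C x) = x) \<and>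
     (\<forall>f\<in>Arr C. \<forall>g\<in>Arr C. Cod C f = Dom C g \<longrightarrow>
        Comp C g f \<in> Arr C \<and> Dom C (Comp C g f) = Dom C f \<and> Cod C (Comp C g f) = Cod C g) \<and>
     (\<forall>f\<in>Arr C. Comp C f (Ide C (Dom C f)) = f \<and> Comp C (Ide C (Cod C f)) f = f) \<and>
     (\<forall>f\<in>Arr C. \<forall>g\<in>Arr C. \<forall>h\<in>Arr C. Cod C f = Dom C g \<and> Cod C g = Dom C h \<longrightarrow>
        Comp C h (Comp C g f) = Comp C (Comp C h g) f)"

definition thin_category :: "('o, 'a) category \<Rightarrow> bool" where
  "thin_category C \<longleftrightarrow> is_category C \<and>
     (\<forall>f\<in>Arr C. \<forall>g\<in>Arr C. Dom C f = Dom C g \<and> Cod C f = Cod C g \<longrightarrow> f = g)"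

record ('o1, 'a1, 'o2, 'a2) functor_data =
  obj_map :: "'o1 \<Rightarrow> 'o2"
  arr_map :: "'a1 \<Rightarrow> 'a2"

definition is_functor ::
  "('o1, 'a1) category \<Rightarrow> ('o2, 'a2) category \<Rightarrow> ('o1, 'a1, 'o2, 'a2) functor_data \<Rightarrow> bool" where
  "is_functor C D F \<longleftrightarrow>
     (\<forall>x\<in>Obj C. obj_map F x \<in> Obj D) \<and>
     (\<forall>f\<in>Arr C. arr_map F f \<in> Arr D \<and>
        Dom D (arr_map F f) = obj_map F (Dom C f) \<and> Cod D (arr_map F f) = obj_map F (Cod C f)) \<and>
     (\<forall>x\<in>Obj C. arr_map F (Ide C x) = Ide D (obj_map F x)) \<and>
     (\<forall>f\<in>Arr C. \<forall>g\<in>Arr C. Cod C f = Dom C g \<longrightarrow>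
        arr_map F (Comp C g f) = Comp D (arr_map F g) (arr_map F f))"

definition comp_functor ::
  "('o2, 'a2, 'o3, 'a3) functor_data \<Rightarrow> ('o1, 'a1, 'o2, 'a2) functor_data \<Rightarrow>
   ('o1, 'a1, 'o3, 'a3) functor_data" where
  "comp_functor G F = \<lparr>obj_map = obj_map G \<circ> obj_map F, arr_map = arr_map G \<circ> arr_map F\<rparr>"


section \<open>The categories of preordered sets, topological spaces and small categories\<close>

text \<open>
  In each of these three categories an arrow is a triple (domain, underlying map, codomain). The
  underlying maps are required to be extensional (\<open>undefined\<close> outside their domain), so that equal
  arrows are equal as HOL values. The ground types are type parameters: a small diagram of preordered
  sets can always be realised with all carriers inside one type \<open>'a\<close>.
\<close>

abbreviation map_of_arr :: "'p \<times> 'm \<times> 'q \<Rightarrow> 'm" where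
  "map_of_arr u \<equiv> fst (snd u)"

type_synonym 'a preord = "'a set \<times> ('a \<times> 'a) set"

text \<open>A preordered set is a pair \<open>(A, r)\<close>, and \<open>(x, y) \<in> r\<close> stands for \<open>x \<le> y\<close>.\<close>

definition Ord_cat :: "('a preord, 'a preord \<times> ('a \<Rightarrow> 'a) \<times> 'a preord) category" where
  "Ord_cat = \<lparr>
     Obj = {P. preorder_on (fst P) (snd P)},
     Arr = {(P, f, Q). preorder_on (fst P) (snd P) \<and> preorder_on (fst Q) (snd Q) \<and>
              f \<in> fst P \<rightarrow>\<^sub>E fst Q \<and> (\<forall>x y. (x, y) \<in> snd P \<longrightarrow> (f x, f y) \<in> snd Q)},
     Dom = (\<lambda>u. fst u),
     Cod = (\<lambda>u. snd (snd u)),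
     Ide = (\<lambda>P. (P, restrict id (fst P), P)),
     Comp = (\<lambda>v u. (fst u, compose (fst (fst u)) (map_of_arr v) (map_of_arr u), snd (snd v)))\<rparr>"

definition Top_cat :: "('a topology, 'a topology \<times> ('a \<Rightarrow> 'a) \<times> 'a topology) category" where
  "Top_cat = \<lparr>
     Obj = UNIV,
     Arr = {(X, f, Y). continuous_map X Y f \<and> f \<in> extensional (topspace X)},
     Dom = (\<lambda>u. fst u),
     Cod = (\<lambda>u. snd (snd u)),
     Ide = (\<lambda>X. (X, restrict id (topspace X), X)),
     Comp = (\<lambda>v u. (fst u, compose (topspace (fst u)) (map_of_arr v) (map_of_arr u), snd (snd v)))\<rparr>"

definition restrict_functor ::
  "('o1, 'a1) category \<Rightarrow> ('o1, 'a1, 'o2, 'a2) functor_data \<Rightarrow> ('o1, 'a1, 'o2, 'a2) functor_data" where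
  "restrict_functor C F =
     \<lparr>obj_map = restrict (obj_map F) (Obj C), arr_map = restrict (arr_map F) (Arr C)\<rparr>"

definition Cat_cat ::
  "(('o, 'a) category,
    ('o, 'a) category \<times> ('o, 'a, 'o, 'a) functor_data \<times> ('o, 'a) category) category" where
  "Cat_cat = \<lparr>
     Obj = {C. is_category C},
     Arr = {(C, F, D). is_category C \<and> is_category D \<and> is_functor C D F \<and>
              obj_map F \<in> extensional (Obj C) \<and> arr_map F \<in> extensional (Arr C)},
     Dom = (\<lambda>u. fst u),
     Cod = (\<lambda>u. snd (snd u)),
     Ide = (\<lambda>C. (C, restrict_functor C \<lparr>obj_map = id, arr_map = id\<rparr>, C)),
     Comp = (\<lambda>v u. (fst u, restrict_functor (fst u) (comp_functor (map_of_arr v) (map_of_arr u)),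
                    snd (snd v)))\<rparr>"

lemma is_category_Ord: "is_category Ord_cat"
  unfolding is_category_def Ord_cat_def
  by (auto simp: preorder_on_def refl_on_def compose_def restrict_def PiE_iff extensional_def fun_eq_iff)

lemma is_category_Top: "is_category Top_cat"
proof -
  have 1: "continuous_map X X (restrict id (topspace X))" for X :: "'a topology"
    by (rule continuous_map_eq[OF continuous_map_id]) auto
  have 2: "continuous_map X Z (compose (topspace X) g f)"
    if "continuous_map X Y f" "continuous_map Y Z g" for X Y Z :: "'a topology" and f g
    by (rule continuous_map_eq[OF continuous_map_compose[OF that]]) (auto simp: compose_def)
  have 3: "f x \<in> topspace Y" if "continuous_map X Y f" "x \<in> topspace X"
    for X Y :: "'a topology" and f x
    using that by (auto simp: continuous_map_def)
  show ?thesis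
    unfolding is_category_def Top_cat_def
    by (auto simp: 1 compose_extensional intro: 2)
      (auto simp: compose_def extensional_def fun_eq_iff 3)
qed

lemma is_category_Cat:
  "is_category (Cat_cat :: (('o, 'a) category,
     ('o, 'a) category \<times> ('o, 'a, 'o, 'a) functor_data \<times> ('o, 'a) category) category)"
proof -
  have id: "is_functor C C (restrict_functor C \<lparr>obj_map = id, arr_map = id\<rparr>)"
    if "is_category C" for C :: "('o, 'a) category"
    using that unfolding is_functor_def is_category_def restrict_functor_def by simp
  have comp: "is_functor C E (restrict_functor C (comp_functor G F))"
    if "is_category C" "is_functor C D F" "is_functor D E G"
    for C D E :: "('o, 'a) category" and F G
    using that unfolding is_functor_def is_category_def restrict_functor_def comp_functor_def
    by simp
  have unit: "restrict_functor C (comp_functor F (restrict_functor C \<lparr>obj_map = id, arr_map = id\<rparr>)) = F"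
    "restrict_functor C (comp_functor (restrict_functor D \<lparr>obj_map = id, arr_map = id\<rparr>) F) = F"
    if "is_functor C D F" "obj_map F \<in> extensional (Obj C)" "arr_map F \<in> extensional (Arr C)"
    for C D :: "('o, 'a) category" and F
    using that unfolding is_functor_def restrict_functor_def comp_functor_def
    by (cases F; auto simp: extensional_def fun_eq_iff)+
  have assoc: "restrict_functor C (comp_functor H (restrict_functor C (comp_functor G F))) =
      restrict_functor C (comp_functor (restrict_functor D (comp_functor H G)) F)"
    if "is_functor C D F" for C D :: "('o, 'a) category" and F G H
    using that unfolding is_functor_def restrict_functor_def comp_functor_def
    by (auto simp: fun_eq_iff)
  have ext: "obj_map (restrict_functor C F) \<in> extensional (Obj C)"
    "arr_map (restrict_functor C F) \<in> extensional (Arr C)"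
    for C :: "('o, 'a) category" and F :: "('o, 'a, 'o, 'a) functor_data"
    by (auto simp: restrict_functor_def)
  show ?thesis
    unfolding is_category_def[of Cat_cat] unfolding Cat_cat_def
    by (auto simp: id ext unit intro: comp assoc)
qed


section \<open>Alexandroff spaces and preordered sets\<close>

definition alexandroff_space :: "'a topology \<Rightarrow> bool" where
  "alexandroff_space X \<longleftrightarrow>
     (\<forall>\<U>. (\<forall>U\<in>\<U>. openin X U) \<longrightarrow> openin X (topspace X \<inter> \<Inter>\<U>))"

definition min_nhd :: "'a topology \<Rightarrow> 'a \<Rightarrow> 'a set" where
  "min_nhd X x = \<Inter>{U. openin X U \<and> x \<in> U}"

definition spec_preord :: "'a topology \<Rightarrow> 'a preord" where
  "spec_preord X =
     (topspace X, {(x, y). x \<in> topspace X \<and> y \<in> topspace X \<and> min_nhd X x \<subseteq> min_nhd X y})"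

text \<open>The open sets of the Alexandroff space of a preordered set are its lower sets.\<close>

definition alex_topology :: "'a preord \<Rightarrow> 'a topology" where
  "alex_topology P =
     topology (\<lambda>U. U \<subseteq> fst P \<and> (\<forall>x\<in>U. \<forall>y\<in>fst P. (y, x) \<in> snd P \<longrightarrow> y \<in> U))"

lemma openin_alex_topology:
  "openin (alex_topology P) U \<longleftrightarrow>
     U \<subseteq> fst P \<and> (\<forall>x\<in>U. \<forall>y\<in>fst P. (y, x) \<in> snd P \<longrightarrow> y \<in> U)"
proof -
  have "istopology (\<lambda>U. U \<subseteq> fst P \<and> (\<forall>x\<in>U. \<forall>y\<in>fst P. (y, x) \<in> snd P \<longrightarrow> y \<in> U))"
    unfolding istopology_def by blast
  then show ?thesis
    by (simp add: alex_topology_def)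
qed

lemma topspace_alex_topology: "topspace (alex_topology P) = fst P"
  unfolding topspace_def by (auto simp: openin_alex_topology)

text \<open>A preordered set as a thin category: the arrow \<open>x \<le> y\<close> is the pair \<open>(x, y)\<close>.\<close>

definition thin_cat :: "'a preord \<Rightarrow> ('a, 'a \<times> 'a) category" where
  "thin_cat P = \<lparr>Obj = fst P, Arr = snd P, Dom = fst, Cod = snd, Ide = (\<lambda>x. (x, x)),
     Comp = (\<lambda>g f. (fst f, snd g))\<rparr>"

text \<open>The preorder on objects for which \<open>x \<le> y\<close> iff there is an arrow from \<open>x\<close> to \<open>y\<close>.\<close>

definition preord_of_category :: "('o, 'a) category \<Rightarrow> 'o preord" where
  "preord_of_category C = (Obj C, {(Dom C f, Cod C f) |f. f \<in> Arr C})"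

lemma thin_category_thin_cat:
  assumes "preorder_on (fst P) (snd P)"
  shows "thin_category (thin_cat P)" and "preord_of_category (thin_cat P) = P"
proof -
  show "thin_category (thin_cat P)"
    using assms unfolding thin_category_def is_category_def thin_cat_def preorder_on_def
    by (auto simp: refl_on_def dest: transD)
  show "preord_of_category (thin_cat P) = P"
    by (simp add: preord_of_category_def thin_cat_def)
qed

definition incl_C ::
  "('a preord, 'a preord \<times> ('a \<Rightarrow> 'a) \<times> 'a preord,
    ('a, 'a \<times> 'a) category,
    ('a, 'a \<times> 'a) category \<times> ('a, 'a \<times> 'a, 'a, 'a \<times> 'a) functor_data \<times> ('a, 'a \<times> 'a) category)
   functor_data" where
  "incl_C = \<lparr>obj_map = thin_cat,
     arr_map = (\<lambda>(P, f, Q).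
       (thin_cat P,
        restrict_functor (thin_cat P) \<lparr>obj_map = f, arr_map = (\<lambda>(x, y). (f x, f y))\<rparr>,
        thin_cat Q))\<rparr>"

definition incl_T ::
  "('a preord, 'a preord \<times> ('a \<Rightarrow> 'a) \<times> 'a preord,
    'a topology, 'a topology \<times> ('a \<Rightarrow> 'a) \<times> 'a topology) functor_data" where
  "incl_T = \<lparr>obj_map = alex_topology,
     arr_map = (\<lambda>(P, f, Q). (alex_topology P, f, alex_topology Q))\<rparr>"

lemma is_functor_incl_C: "is_functor Ord_cat Cat_cat incl_C"
proof -
  have cat: "is_category (thin_cat P)" if "preorder_on (fst P) (snd P)" for P :: "'a preord"
    using thin_category_thin_cat(1)[OF that] by (simp add: thin_category_def)
  have arr: "is_functor (thin_cat P) (thin_cat Q)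
      (restrict_functor (thin_cat P) \<lparr>obj_map = f, arr_map = (\<lambda>(x, y). (f x, f y))\<rparr>)"
    if "preorder_on (fst P) (snd P)" "f \<in> fst P \<rightarrow>\<^sub>E fst Q" "\<forall>x y. (x, y) \<in> snd P \<longrightarrow> (f x, f y) \<in> snd Q"
    for P Q :: "'a preord" and f
    using that unfolding is_functor_def thin_cat_def restrict_functor_def preorder_on_def
    by (auto simp: refl_on_def dest: transD)
  have dom: "x \<in> A \<and> y \<in> A" if "preorder_on A r" "(x, y) \<in> r" for A :: "'a set" and r x y
    using that by (auto simp: preorder_on_def)
  show ?thesis
    unfolding is_functor_def[of Ord_cat] unfolding Ord_cat_def Cat_cat_def incl_C_def
    by (auto intro!: cat arr)
      (auto simp: restrict_functor_def thin_cat_def comp_functor_def compose_def fun_eq_iff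
        PiE_iff dest: dom)
qed

lemma is_functor_incl_T: "is_functor Ord_cat Top_cat incl_T"
proof -
  have "continuous_map (alex_topology P) (alex_topology Q) f"
    if "f \<in> fst P \<rightarrow>\<^sub>E fst Q" "\<forall>x y. (x, y) \<in> snd P \<longrightarrow> (f x, f y) \<in> snd Q"
    for P Q :: "'a preord" and f
    using that unfolding continuous_map_def topspace_alex_topology openin_alex_topology
    by (auto simp: PiE_iff)
  then show ?thesis
    unfolding is_functor_def[of Ord_cat] unfolding Ord_cat_def Top_cat_def incl_T_def
    by (auto simp: topspace_alex_topology PiE_iff)
qed


section \<open>Grothendieck constructions\<close>

text \<open>
  For a functor \<open>F\<close> from a small category \<open>C\<close> to \<open>Cat\<close>, an arrow from \<open>(b, x)\<close> to \<open>(b', x')\<close> is a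
  pair \<open>(u, f)\<close> with \<open>u : b \<rightarrow> b'\<close> in \<open>C\<close> and \<open>f : F(u)(x) \<rightarrow> x'\<close> in \<open>F(b')\<close>; it is again stored
  together with its domain and codomain.
\<close>

definition grothendieck ::
  "('b, 'u) category \<Rightarrow>
   ('b, 'u, ('o, 'a) category,
    ('o, 'a) category \<times> ('o, 'a, 'o, 'a) functor_data \<times> ('o, 'a) category) functor_data \<Rightarrow>
   ('b \<times> 'o, ('b \<times> 'o) \<times> ('u \<times> 'a) \<times> ('b \<times> 'o)) category" where
  "grothendieck C F = \<lparr>
     Obj = (SIGMA b:Obj C. Obj (obj_map F b)),
     Arr = {((b, x), (u, f), (b', x')).
              u \<in> Arr C \<and> Dom C u = b \<and> Cod C u = b' \<and> x \<in> Obj (obj_map F b) \<and>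
              f \<in> Arr (obj_map F b') \<and>
              Dom (obj_map F b') f = obj_map (map_of_arr (arr_map F u)) x \<and>
              Cod (obj_map F b') f = x'},
     Dom = (\<lambda>w. fst w),
     Cod = (\<lambda>w. snd (snd w)),
     Ide = (\<lambda>(b, x). ((b, x), (Ide C b, Ide (obj_map F b) x), (b, x))),
     Comp = (\<lambda>(p', (v, g), q') (p, (u, f), q).
       (p, (Comp C v u, Comp (obj_map F (Cod C v)) g (arr_map (map_of_arr (arr_map F v)) f)), q'))\<rparr>"

text \<open>
  The basic open set \<open>J\<^sub>G(b, V)\<close>. In the base category \<open>thin_cat (spec_preord B)\<close> the arrow \<open>v \<le> b\<close> is
  the pair \<open>(v, b)\<close>.
\<close>

definition basic_open ::
  "'b topology \<Rightarrow>
   ('b, 'b \<times> 'b, 'a topology, 'a topology \<times> ('a \<Rightarrow> 'a) \<times> 'a topology) functor_data \<Rightarrow>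
   'b \<Rightarrow> 'a set \<Rightarrow> ('b \<times> 'a) set" where
  "basic_open B G b V =
     (\<Union>v\<in>min_nhd B b. {v} \<times> {y \<in> topspace (obj_map G v). map_of_arr (arr_map G (v, b)) y \<in> V})"

definition top_grothendieck ::
  "'b topology \<Rightarrow>
   ('b, 'b \<times> 'b, 'a topology, 'a topology \<times> ('a \<Rightarrow> 'a) \<times> 'a topology) functor_data \<Rightarrow>
   ('b \<times> 'a) topology" where
  "top_grothendieck B G =
     topology (arbitrary union_of
       (\<lambda>S. \<exists>b V. b \<in> topspace B \<and> openin (obj_map G b) V \<and> S = basic_open B G b V))"

end

theory Submission
  imports Defs
begin

text \<open>
  The principal lower set of \<open>(b, x)\<close> in \<open>\<integral>D\<^sub>C\<close> is \<open>J(b, {y. y \<le> x})\<close>. Hence every lower set is a union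
  of sets \<open>J(b, V)\<close>; conversely every \<open>J(b, V)\<close> with \<open>V\<close> a lower set of \<open>D(b)\<close> is a lower set, by
  functoriality and monotonicity of the transition maps.
\<close>

section \<open>Minimal neighbourhoods and the specialization preorder\<close>

lemma mem_min_nhd_iff:
  assumes "v \<in> topspace X"
  shows "v \<in> min_nhd X b \<longleftrightarrow> min_nhd X v \<subseteq> min_nhd X b"
  \<comment> \<open>If \<open>v\<close> lies in \<open>min_nhd X b\<close>, every open set around
    \<open>b\<close> is also one around \<open>v\<close>, so the family intersected for
    \<open>v\<close> is the larger one. Conversely, \<open>v\<close> always lies in
    \<open>min_nhd X v\<close>.\<close>
  using assms by (auto simp: min_nhd_def)

text \<open>The whole space is among the neighbourhoods intersected. For \<open>b\<close> outside
  the space that family is empty and \<open>min_nhd X b\<close> is \<open>UNIV\<close>.\<close>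

lemma min_nhd_subset_topspace: "b \<in> topspace X \<Longrightarrow> min_nhd X b \<subseteq> topspace X"
  unfolding min_nhd_def by blast

lemma preorder_on_spec_preord: "preorder_on (fst (spec_preord X)) (snd (spec_preord X))"
  by (auto simp: spec_preord_def preorder_on_def refl_on_def trans_def)

text \<open>Translates the index set of the union in \<open>basic_open\<close> into the arrows of
  the base category that end in \<open>b\<close>.\<close>

lemma spec_preord_iff_min_nhd:
  assumes "b \<in> topspace X"
  shows "(v, b) \<in> snd (spec_preord X) \<longleftrightarrow> v \<in> min_nhd X b"
  using assms mem_min_nhd_iff[of v X b] min_nhd_subset_topspace[OF assms]
  by (auto simp: spec_preord_def)

text \<open>The categorical half depends on the base only through its preorder, so it is developed
  over an arbitrary \<open>P\<close>; the space \<open>B\<close> enters by taking \<open>P\<close>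
  to be \<open>spec_preord B\<close>.\<close>

locale ord_diagram =
  fixes P :: "'b preord"
    and D :: "('b, 'b \<times> 'b, 'a preord, 'a preord \<times> ('a \<Rightarrow> 'a) \<times> 'a preord) functor_data"
  assumes preorder_base: "preorder_on (fst P) (snd P)"
    and functor_D: "is_functor (thin_cat P) Ord_cat D"
begin

abbreviation fibre :: "'b \<Rightarrow> 'a set" where
  "fibre b \<equiv> fst (obj_map D b)"

abbreviation fibre_le :: "'b \<Rightarrow> ('a \<times> 'a) set" where
  "fibre_le b \<equiv> snd (obj_map D b)"

abbreviation trans_map :: "'b \<Rightarrow> 'b \<Rightarrow> 'a \<Rightarrow> 'a" where
  "trans_map b c \<equiv> map_of_arr (arr_map D (b, c))"

abbreviation total_preord :: "('b \<times> 'a) preord" where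
  "total_preord \<equiv> preord_of_category (grothendieck (thin_cat P) (comp_functor incl_C D))"

section \<open>Order on base and fibres, and the transition maps\<close>

lemma base_mem: "(b, c) \<in> snd P \<Longrightarrow> b \<in> fst P \<and> c \<in> fst P"
  using preorder_base by (auto simp: preorder_on_def)

lemma base_refl: "b \<in> fst P \<Longrightarrow> (b, b) \<in> snd P"
  using preorder_base by (auto simp: preorder_on_def refl_on_def)

lemma base_trans: "(b, c) \<in> snd P \<Longrightarrow> (c, d) \<in> snd P \<Longrightarrow> (b, d) \<in> snd P"
  using preorder_base by (auto simp: preorder_on_def dest: transD)

lemma preorder_fibre: "b \<in> fst P \<Longrightarrow> preorder_on (fibre b) (fibre_le b)"
  using functor_D by (auto simp: is_functor_def thin_cat_def Ord_cat_def)

lemma fibre_mem: "b \<in> fst P \<Longrightarrow> (x, y) \<in> fibre_le b \<Longrightarrow> x \<in> fibre b \<and> y \<in> fibre b"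
  using preorder_fibre[of b] by (auto simp: preorder_on_def)

lemma fibre_refl: "b \<in> fst P \<Longrightarrow> x \<in> fibre b \<Longrightarrow> (x, x) \<in> fibre_le b"
  using preorder_fibre[of b] by (auto simp: preorder_on_def refl_on_def)

lemma fibre_trans:
  "b \<in> fst P \<Longrightarrow> (x, y) \<in> fibre_le b \<Longrightarrow> (y, z) \<in> fibre_le b \<Longrightarrow> (x, z) \<in> fibre_le b"
  using preorder_fibre[of b] by (auto simp: preorder_on_def dest: transD)

lemma arr_map_in:
  assumes "(b, c) \<in> snd P"
  shows "arr_map D (b, c) \<in> Arr Ord_cat"
  using functor_D assms unfolding is_functor_def by (simp add: thin_cat_def)

text \<open>Arrows of \<open>Ord_cat\<close> store their endpoints, and a functor preserves
  \<open>Dom\<close> and \<open>Cod\<close>; so only the middle component carries new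
  information.\<close>

lemma arr_map_eq:
  assumes "(b, c) \<in> snd P"
  shows "arr_map D (b, c) = (obj_map D b, trans_map b c, obj_map D c)"
proof -
  have "(b, c) \<in> Arr (thin_cat P)"
    using assms by (simp add: thin_cat_def)
  then have "Dom Ord_cat (arr_map D (b, c)) = obj_map D (Dom (thin_cat P) (b, c))"
    "Cod Ord_cat (arr_map D (b, c)) = obj_map D (Cod (thin_cat P) (b, c))"
    using functor_D unfolding is_functor_def by blast+
  then show ?thesis
    by (simp add: Ord_cat_def thin_cat_def prod_eq_iff)
qed

lemma trans_map_hom:
  assumes "(b, c) \<in> snd P"
  shows "trans_map b c \<in> fibre b \<rightarrow>\<^sub>E fibre c"
    and "(x, y) \<in> fibre_le b \<Longrightarrow> (trans_map b c x, trans_map b c y) \<in> fibre_le c"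
proof -
  obtain f where f: "arr_map D (b, c) = (obj_map D b, f, obj_map D c)"
    using arr_map_eq[OF assms] by blast
  show "trans_map b c \<in> fibre b \<rightarrow>\<^sub>E fibre c"
    and "(x, y) \<in> fibre_le b \<Longrightarrow> (trans_map b c x, trans_map b c y) \<in> fibre_le c"
    using arr_map_in[OF assms] by (simp_all add: f Ord_cat_def)
qed

lemma trans_map_in:
  "(b, c) \<in> snd P \<Longrightarrow> x \<in> fibre b \<Longrightarrow> trans_map b c x \<in> fibre c"
  using trans_map_hom(1) by (rule PiE_mem)

lemma trans_map_id:
  assumes "b \<in> fst P" and "x \<in> fibre b"
  shows "trans_map b b x = x"
  using functor_D assms unfolding is_functor_def by (simp add: thin_cat_def Ord_cat_def)

lemma trans_map_comp:
  assumes "(b, c) \<in> snd P" and "(c, d) \<in> snd P" and "x \<in> fibre b"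
  shows "trans_map b d x = trans_map c d (trans_map b c x)"
proof -
  have "(b, c) \<in> Arr (thin_cat P)" "(c, d) \<in> Arr (thin_cat P)"
    and "Cod (thin_cat P) (b, c) = Dom (thin_cat P) (c, d)"
    and comp: "Comp (thin_cat P) (c, d) (b, c) = (b, d)"
    using assms by (simp_all add: thin_cat_def)
  then have "arr_map D (Comp (thin_cat P) (c, d) (b, c)) =
      Comp Ord_cat (arr_map D (c, d)) (arr_map D (b, c))"
    using functor_D unfolding is_functor_def by blast
  then have "arr_map D (b, d) = Comp Ord_cat (arr_map D (c, d)) (arr_map D (b, c))"
    unfolding comp .
  \<comment> \<open>\<open>compose\<close> is cut off at the carrier stored in the first component
    of the arrow; that carrier has to be recognised as the fibre over \<open>b\<close> before
    evaluating at \<open>x\<close>.\<close>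
  moreover have "fst (arr_map D (b, c)) = obj_map D b"
    by (subst arr_map_eq[OF assms(1)]) simp
  ultimately show ?thesis
    using assms(3) by (simp add: Ord_cat_def compose_def)
qed

section \<open>The Grothendieck construction as a thin category\<close>

lemma Obj_total:
  "Obj (grothendieck (thin_cat P) (comp_functor incl_C D)) = (SIGMA b:fst P. fibre b)"
  by (simp add: grothendieck_def comp_functor_def incl_C_def thin_cat_def)

text \<open>\<open>incl_C\<close> yields extensional functors, so they agree with the transition map
  only on the fibre; the companion for arrows below is limited in the same way to related
  pairs.\<close>

lemma obj_map_incl_C:
  assumes "(b, c) \<in> snd P" and "x \<in> fibre b"
  shows "obj_map (map_of_arr (arr_map (comp_functor incl_C D) (b, c))) x = trans_map b c x"
  using assms arr_map_eq[OF assms(1)]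
  by (cases "arr_map D (b, c)")
     (simp add: comp_functor_def incl_C_def restrict_functor_def thin_cat_def)

lemma arr_map_incl_C:
  assumes "(b, c) \<in> snd P" and "(x, y) \<in> fibre_le b"
  shows "arr_map (map_of_arr (arr_map (comp_functor incl_C D) (b, c))) (x, y) =
    (trans_map b c x, trans_map b c y)"
  using assms arr_map_eq[OF assms(1)]
  by (cases "arr_map D (b, c)")
     (simp add: comp_functor_def incl_C_def restrict_functor_def thin_cat_def)

lemma obj_comp_incl_C: "obj_map (comp_functor incl_C D) b = thin_cat (obj_map D b)"
  by (simp add: comp_functor_def incl_C_def)

text \<open>An arrow in a thin fibre is a pair, and the \<open>Dom\<close> condition forces its
  first entry to be the image of \<open>x\<close>. Hence the endpoints determine the whole arrow,
  which is the source of thinness.\<close>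

lemma Arr_total:
  "Arr (grothendieck (thin_cat P) (comp_functor incl_C D)) =
     {((b, x), ((b, c), (trans_map b c x, y)), (c, y)) |b x c y.
        (b, c) \<in> snd P \<and> x \<in> fibre b \<and> (trans_map b c x, y) \<in> fibre_le c}"
proof -
  have "Arr (grothendieck (thin_cat P) (comp_functor incl_C D)) =
      {((b, x), (u, f), (c, y)). u = (b, c) \<and> u \<in> snd P \<and> x \<in> fibre b \<and> f \<in> fibre_le c \<and>
        fst f = obj_map (map_of_arr (arr_map (comp_functor incl_C D) u)) x \<and> snd f = y}"
    by (auto simp: grothendieck_def obj_comp_incl_C thin_cat_def)
  then show ?thesis
    by (auto simp: obj_map_incl_C)
qed

lemma total_preord_iff:
  "((b, x), (c, y)) \<in> snd total_preord \<longleftrightarrow>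
     (b, c) \<in> snd P \<and> x \<in> fibre b \<and> (trans_map b c x, y) \<in> fibre_le c"
  unfolding preord_of_category_def Arr_total by (auto simp: grothendieck_def)

lemma fst_total_preord: "fst total_preord = (SIGMA b:fst P. fibre b)"
  by (simp add: preord_of_category_def Obj_total)

text \<open>Apply the monotone map D(c \<le> d) to D(b \<le> c)(x) \<le> y, rewrite the left side by
  functoriality, and continue with D(c \<le> d)(y) \<le> z.\<close>

lemma total_le_trans:
  assumes "(b, c) \<in> snd P" "x \<in> fibre b" "(trans_map b c x, y) \<in> fibre_le c"
    and "(c, d) \<in> snd P" "(trans_map c d y, z) \<in> fibre_le d"
  shows "(trans_map b d x, z) \<in> fibre_le d"
  using trans_map_hom(2)[OF assms(4,3)] trans_map_comp[OF assms(1,4,2)] assms(4,5)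
    fibre_trans base_mem by metis

lemma thin_category_total:
  "thin_category (grothendieck (thin_cat P) (comp_functor incl_C D))" (is "thin_category ?G")
proof -
  have Dom: "Dom ?G = fst" and Cod: "Cod ?G = (\<lambda>w. snd (snd w))"
    by (simp_all add: grothendieck_def)
  have Ide: "Ide ?G (b, x) = ((b, x), ((b, b), (x, x)), (b, x))" for b x
    by (simp add: grothendieck_def obj_comp_incl_C thin_cat_def)
  \<comment> \<open>The entry \<open>x'\<close> is left arbitrary because in iterated composites it
    is an iterated image under transition maps, not literally
    \<open>trans_map b c x\<close>.\<close>
  have Comp: "Comp ?G ((c, y), ((c, d), (y', z)), (d, z)) ((b, x), ((b, c), (x', y)), (c, y)) =
      ((b, x), ((b, d), (trans_map c d x', z)), (d, z))"
    if "(c, d) \<in> snd P" "(x', y) \<in> fibre_le c" for b c d x x' y y' z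
    using arr_map_incl_C[OF that]
    by (simp add: grothendieck_def obj_comp_incl_C thin_cat_def)
  have arr_total: "((b, x), ((b, c), (x', y)), (c, y)) \<in> Arr ?G \<longleftrightarrow>
      (b, c) \<in> snd P \<and> x \<in> fibre b \<and> (x', y) \<in> fibre_le c \<and> x' = trans_map b c x" for b c x x' y
    by (auto simp: Arr_total)
  have arr_E: thesis
    if "w \<in> Arr ?G"
      "\<And>b c x y. w = ((b, x), ((b, c), (trans_map b c x, y)), (c, y)) \<Longrightarrow> (b, c) \<in> snd P \<Longrightarrow>
        x \<in> fibre b \<Longrightarrow> (trans_map b c x, y) \<in> fibre_le c \<Longrightarrow> b \<in> fst P \<Longrightarrow> c \<in> fst P \<Longrightarrow>
        y \<in> fibre c \<Longrightarrow> thesis" for w thesis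
    using that base_mem fibre_mem unfolding Arr_total by blast
  have "is_category ?G"
    unfolding is_category_def
  proof (intro conjI ballI impI; (elim conjE)?)
    fix f assume "f \<in> Arr ?G"
    then show "Dom ?G f \<in> Obj ?G" "Cod ?G f \<in> Obj ?G"
      by (auto elim!: arr_E simp: Dom Cod Obj_total)
    show "Comp ?G f (Ide ?G (Dom ?G f)) = f" "Comp ?G (Ide ?G (Cod ?G f)) f = f"
      using \<open>f \<in> Arr ?G\<close>
      by (auto elim!: arr_E simp: Dom Cod Ide Comp base_refl fibre_refl trans_map_id trans_map_in)
  next
    fix p assume "p \<in> Obj ?G"
    then show "Ide ?G p \<in> Arr ?G" "Dom ?G (Ide ?G p) = p" "Cod ?G (Ide ?G p) = p"
      by (auto simp: Obj_total Ide arr_total Dom Cod base_refl fibre_refl trans_map_id)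
  next
    fix f g assume fg: "f \<in> Arr ?G" "g \<in> Arr ?G" "Cod ?G f = Dom ?G g"
    obtain b c x y where f: "f = ((b, x), ((b, c), (trans_map b c x, y)), (c, y))"
      and bc: "(b, c) \<in> snd P" "x \<in> fibre b" "(trans_map b c x, y) \<in> fibre_le c"
      using fg(1) by (rule arr_E)
    obtain d z where g: "g = ((c, y), ((c, d), (trans_map c d y, z)), (d, z))"
      and cd: "(c, d) \<in> snd P" "(trans_map c d y, z) \<in> fibre_le d"
      using fg(2) by (rule arr_E) (use fg(3) f in \<open>auto simp: Dom Cod\<close>)
    have gf: "Comp ?G g f = ((b, x), ((b, d), (trans_map b d x, z)), (d, z))"
      unfolding f g by (simp only: Comp[OF cd(1) bc(3)] trans_map_comp[OF bc(1) cd(1) bc(2)])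
    show "Comp ?G g f \<in> Arr ?G"
      unfolding gf arr_total using base_trans[OF bc(1) cd(1)] bc(2) total_le_trans[OF bc cd] by simp
    show "Dom ?G (Comp ?G g f) = Dom ?G f" "Cod ?G (Comp ?G g f) = Cod ?G g"
      unfolding gf by (simp_all add: Dom Cod f g)
  next
    fix f g h assume fgh: "f \<in> Arr ?G" "g \<in> Arr ?G" "h \<in> Arr ?G"
      "Cod ?G f = Dom ?G g" "Cod ?G g = Dom ?G h"
    obtain b c x y where f: "f = ((b, x), ((b, c), (trans_map b c x, y)), (c, y))"
      and bc: "(b, c) \<in> snd P" "x \<in> fibre b" "(trans_map b c x, y) \<in> fibre_le c"
      using fgh(1) by (rule arr_E)
    obtain d z where g: "g = ((c, y), ((c, d), (trans_map c d y, z)), (d, z))"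
      and cd: "(c, d) \<in> snd P" "y \<in> fibre c" "(trans_map c d y, z) \<in> fibre_le d"
      using fgh(2) by (rule arr_E) (use fgh(4) f in \<open>auto simp: Dom Cod\<close>)
    obtain e w where h: "h = ((d, z), ((d, e), (trans_map d e z, w)), (e, w))"
      and de: "(d, e) \<in> snd P" "(trans_map d e z, w) \<in> fibre_le e"
      using fgh(3) by (rule arr_E) (use fgh(5) g in \<open>auto simp: Dom Cod\<close>)
    \<comment> \<open>This makes the fibre component of the inner composite an arrow over
      \<open>d\<close>, as \<open>Comp\<close> requires. The two bracketings then differ only in D(d
      \<le> e) after D(c \<le> d) versus D(c \<le> e).\<close>
    have "(trans_map c d (trans_map b c x), z) \<in> fibre_le d"
      using total_le_trans[OF bc cd(1,3)] trans_map_comp[OF bc(1) cd(1) bc(2)] by simp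
    then have "Comp ?G h (Comp ?G g f) =
        ((b, x), ((b, e), (trans_map d e (trans_map c d (trans_map b c x)), w)), (e, w))"
      unfolding f g h by (simp only: Comp[OF cd(1) bc(3)] Comp[OF de(1)])
    moreover have "Comp ?G (Comp ?G h g) f =
        ((b, x), ((b, e), (trans_map c e (trans_map b c x), w)), (e, w))"
      unfolding f g h
      by (simp only: Comp[OF de(1) cd(3)] Comp[OF base_trans[OF cd(1) de(1)] bc(3)])
    ultimately show "Comp ?G h (Comp ?G g f) = Comp ?G (Comp ?G h g) f"
      using trans_map_comp[OF cd(1) de(1) trans_map_in[OF bc(1,2)]] by simp
  qed
  then show ?thesis
    unfolding thin_category_def by (auto elim!: arr_E simp: Dom Cod)
qed

end

section \<open>Comparison of the two topologies\<close>

theorem proposition3p3: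
  fixes B :: "'b topology"
    and D :: "('b, 'b \<times> 'b, 'a preord, 'a preord \<times> ('a \<Rightarrow> 'a) \<times> 'a preord) functor_data"
  assumes "alexandroff_space B"
    and "is_functor (thin_cat (spec_preord B)) Ord_cat D"
  shows "thin_category (grothendieck (thin_cat (spec_preord B)) (comp_functor incl_C D))
    \<and> alex_topology
           (preord_of_category (grothendieck (thin_cat (spec_preord B)) (comp_functor incl_C D)))
         = top_grothendieck B (comp_functor incl_T D)"
proof -
  interpret ord_diagram "spec_preord B" D
    by unfold_locales (rule preorder_on_spec_preord assms(2))+
  have base: "fst (spec_preord B) = topspace B"
    by (simp add: spec_preord_def)
  have fibre_top: "obj_map (comp_functor incl_T D) b = alex_topology (obj_map D b)" for b
    by (simp add: comp_functor_def incl_T_def)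
  have arr_top: "map_of_arr (arr_map (comp_functor incl_T D) (v, b)) = trans_map v b" for v b
    by (cases "arr_map D (v, b)") (simp add: comp_functor_def incl_T_def)
  \<comment> \<open>In this form membership in J(b, V) can be matched directly with
    \<open>total_preord_iff\<close>.\<close>
  have J: "(v, y) \<in> basic_open B (comp_functor incl_T D) b V \<longleftrightarrow>
      (v, b) \<in> snd (spec_preord B) \<and> y \<in> fibre v \<and> trans_map v b y \<in> V"
    if "b \<in> topspace B" for v y b V
    unfolding basic_open_def fibre_top arr_top topspace_alex_topology
    using spec_preord_iff_min_nhd[OF that] by auto
  let ?basis = "\<lambda>S. \<exists>b V. b \<in> topspace B \<and> openin (obj_map (comp_functor incl_T D) b) V \<and>
    S = basic_open B (comp_functor incl_T D) b V"
  have basic: "openin (alex_topology total_preord) S" if basis: "?basis S" for S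
  proof -
    obtain b V where b: "b \<in> topspace B" and V: "openin (alex_topology (obj_map D b)) V"
      and S: "S = basic_open B (comp_functor incl_T D) b V"
      using basis fibre_top by auto
    have "S \<subseteq> fst total_preord"
      using base_mem unfolding S fst_total_preord by (auto simp: J[OF b])
    moreover have "(v, y) \<in> S"
      if le: "((v, y), (w, z)) \<in> snd total_preord" and wz: "(w, z) \<in> S" for v y w z
    proof -
      have vw: "(v, w) \<in> snd (spec_preord B)" and y: "y \<in> fibre v"
        and yz: "(trans_map v w y, z) \<in> fibre_le w"
        using le by (auto simp: total_preord_iff)
      have wb: "(w, b) \<in> snd (spec_preord B)" and zV: "trans_map w b z \<in> V"
        using wz by (auto simp: S J[OF b])
      have vb: "(v, b) \<in> snd (spec_preord B)"
        using base_trans[OF vw wb] .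
      \<comment> \<open>D(w \<le> b) is applied to D(v \<le> w)(y) \<le> z. As \<open>V\<close> is a
        lower set containing the right-hand side, it also contains D(v \<le> b)(y).\<close>
      have "(trans_map v b y, trans_map w b z) \<in> fibre_le b"
        using trans_map_hom(2)[OF wb yz] trans_map_comp[OF vw wb y] by simp
      then have "trans_map v b y \<in> V"
        using V zV trans_map_in[OF vb y] unfolding openin_alex_topology by blast
      then show ?thesis
        using vb y by (simp add: S J[OF b])
    qed
    ultimately show ?thesis
      unfolding openin_alex_topology by fast
  qed
  have union: "(arbitrary union_of ?basis) W" if W: "openin (alex_topology total_preord) W" for W
  proof -
    let ?J = "\<lambda>(b, x). basic_open B (comp_functor incl_T D) b {y. (y, x) \<in> fibre_le b}"
    have J_basis: "?basis (?J (b, x))" if bx: "(b, x) \<in> W" for b x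
    proof -
      have b: "b \<in> topspace B"
        using W bx unfolding openin_alex_topology fst_total_preord base by auto
      have "openin (alex_topology (obj_map D b)) {y. (y, x) \<in> fibre_le b}"
        using b base fibre_mem[of b] fibre_trans[of b] unfolding openin_alex_topology by blast
      then show ?thesis
        using b by (auto simp: fibre_top)
    qed
    have "?J (b, x) \<subseteq> W" and "(b, x) \<in> ?J (b, x)" if bx: "(b, x) \<in> W" for b x
    proof -
      have b: "b \<in> topspace B" and x: "x \<in> fibre b"
        using W bx unfolding openin_alex_topology fst_total_preord base by auto
      show "(b, x) \<in> ?J (b, x)"
        using b x by (simp add: J base base_refl trans_map_id fibre_refl)
      show "?J (b, x) \<subseteq> W"
      proof clarify
        fix v y assume "(v, y) \<in> basic_open B (comp_functor incl_T D) b {y. (y, x) \<in> fibre_le b}"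
        \<comment> \<open>For the principal lower set of \<open>x\<close> as \<open>V\<close>, the
          condition in \<open>J\<close> is exactly that of \<open>total_preord_iff\<close>.\<close>
        then have "((v, y), (b, x)) \<in> snd total_preord"
          by (simp add: J[OF b] total_preord_iff)
        moreover from this have "(v, y) \<in> fst total_preord"
          using base_mem unfolding fst_total_preord total_preord_iff by auto
        ultimately show "(v, y) \<in> W"
          using W bx unfolding openin_alex_topology by blast
      qed
    qed
    then have "W = \<Union>(?J ` W)"
      by fast
    moreover have "?basis (?J p)" if "p \<in> W" for p
      using J_basis[of "fst p" "snd p"] that by (simp only: prod.collapse)
    then have "?J ` W \<subseteq> Collect ?basis"
      by (intro image_subsetI CollectI)
    ultimately show ?thesis
      \<comment> \<open>The witness is the family of all principal lower sets at points of
        \<open>W\<close>; \<open>arbitrary\<close> puts no condition on it.\<close>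
      unfolding union_of_def arbitrary_def by (intro exI[of _ "?J ` W"] conjI TrueI) simp_all
  qed
  \<comment> \<open>Equality is shown for the predicates of open sets. It also yields that unions of
    the sets J(b, V) form a topology, so that \<open>topology\<close> returns the intended space, by
    \<open>openin_inverse\<close>.\<close>
  have "openin (alex_topology total_preord) = arbitrary union_of ?basis"
  proof (intro ext iffI)
    fix W assume "(arbitrary union_of ?basis) W"
    then obtain \<U> where "\<U> \<subseteq> Collect ?basis" and "\<Union>\<U> = W"
      unfolding union_of_def by (elim exE conjE)
    then show "openin (alex_topology total_preord) W"
      using openin_Union[of \<U> "alex_topology total_preord"] basic by (auto simp only:)
  qed (rule union)
  then have "alex_topology total_preord = top_grothendieck B (comp_functor incl_T D)"
    unfolding top_grothendieck_def by (metis openin_inverse)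
  then show ?thesis
    using thin_category_total by blast
qed

end
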